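(* Each of the following sets is a Meyer set in $\mathbb{C}\cong\mathbb{R}^2$: (1) $Q_{\lambda_5}(P_5)$ and $Q_{\lambda_5}(P_{10})$; (2) $Q_{\lambda_7}(P_7)$ and $Q_{\lambda_7}(P_{14})$; (3) $Q_{2+\sqrt2}(P_8)$; (4) $Q_{2+\sqrt3}(P_{12})$; (5) $Q_{\lambda_9}(P_9)$ and $Q_{\lambda_9}(P_{18})$; (6) $Q_{\lambda_{15}}(P_{15})$ and $Q_{\lambda_{15}}(P_{30})$.
   Context: For $\lambda\in\mathbb{C}$, a set $A\subseteq\mathbb{C}$ is $\lambda$-convex if for all $a,b\in A$ the point $(1-\lambda)a+\lambda b$ is in $A$. For $S\subseteq\mathbb{C}$, $Q_\lambda(S)$ denotes the smallest $\lambda$-convex set containing $S$. For an integer $n\ge 3$, $P_n:=\left\{\sum_{j=0}^{\ell-1}\zeta^j : 0\le\ell<n\right\}$ with $\zeta=e^{2\pi i/n}$, i.e. the vertex set of the regular $n$-gon with one side equal to $[0,1]$ and lying in the upper half-plane. For such $n$, $\lambda_n:=\dfrac{1}{2(1-\cos(\pi/n))}$. A set $A\subseteq\mathbb{R}^m$ is a Meyer set if it is relatively dense in $\mathbb{R}^m$ (there is $R>0$ such that the balls of radius $R$ centered at points of $A$ cover $\mathbb{R}^m$) and $A-A=\{x-y : x,y\in A\}$ is uniformly discrete (distances between distinct points are bounded below by a positive constant). *)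

theory Defs
  imports "HOL-Analysis.Analysis"
begin

definition lambda_convex :: "complex \<Rightarrow> complex set \<Rightarrow> bool" where
  "lambda_convex l A \<longleftrightarrow> (\<forall>a\<in>A. \<forall>b\<in>A. (1 - l) * a + l * b \<in> A)"

definition Q :: "complex \<Rightarrow> complex set \<Rightarrow> complex set" where
  "Q l S = lambda_convex l hull S"

text \<open>The hull is an intersection; these facts show that it is indeed the smallest
  \<open>\<lambda>\<close>-convex set containing \<open>S\<close>.\<close>

lemma lambda_convex_Q: "lambda_convex l (Q l S)"
  unfolding Q_def by (rule hull_in) (auto simp: lambda_convex_def)

lemma subset_Q: "S \<subseteq> Q l S"
  unfolding Q_def by (rule hull_subset)

lemma Q_minimal: "S \<subseteq> A \<Longrightarrow> lambda_convex l A \<Longrightarrow> Q l S \<subseteq> A"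
  unfolding Q_def by (rule hull_minimal)

text \<open>Meaningful for \<open>n \<ge> 3\<close>: the partial sums are the vertices of the regular \<open>n\<close>-gon, in
  counterclockwise order starting with \<open>0\<close> and \<open>1\<close>.\<close>

definition P :: "nat \<Rightarrow> complex set" where
  "P n = {\<Sum>j<l. cis (2 * pi / real n) ^ j | l. l < n}"

definition lam :: "nat \<Rightarrow> real" where
  "lam n = 1 / (2 * (1 - cos (pi / real n)))"

definition relatively_dense :: "'a::metric_space set \<Rightarrow> bool" where
  "relatively_dense A \<longleftrightarrow> (\<exists>R>0. (\<Union>a\<in>A. ball a R) = UNIV)"

definition meyer_set :: "'a::euclidean_space set \<Rightarrow> bool" where
  "meyer_set A \<longleftrightarrow> relatively_dense A \<and> uniform_discrete {x - y | x y. x \<in> A \<and> y \<in> A}"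

end

theory Submission
  imports Defs "HOL-Computational_Algebra.Primes" "HOL-Computational_Algebra.Polynomial"
begin

text \<open>
  Relative density holds for every real \<open>\<lambda> > 1\<close>. On the line, if \<open>T\<close> is \<open>g\<close>-dense in an interval
  of half-length \<open>L\<close>, then \<open>(1 - \<lambda>) T + \<lambda> T\<close> is \<open>\<lambda> g\<close>-dense in an interval of half-length about
  \<open>(2 \<lambda> - 1) L\<close>, so the ratio \<open>L / g\<close> grows without bound. Once it exceeds \<open>\<lambda> + 1\<close>, density at one
  fixed scale propagates outwards: expand by \<open>\<lambda>\<close> and correct the error by the choice of the centre.
  In the plane, a \<open>\<lambda>\<close>-convex set containing \<open>0\<close>, \<open>1\<close>, \<open>w\<close> contains \<open>\<lambda> T + (1 - \<lambda>) T w\<close>.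

  For the difference set, \<open>\<lambda>\<close> lies in \<open>\<int>[\<zeta>]\<close> and its conjugates under \<open>\<zeta> \<mapsto> \<zeta>\<^sup>k\<close>, \<open>k \<noteq> \<plusminus>1\<close>, lie in \<open>[0, 1]\<close>;
  hence these conjugations map the \<open>\<lambda>\<close>-hull to a bounded set. An element of \<open>\<int>[\<zeta>]\<close> all of whose
  conjugates are bounded is determined by the bounded integers \<open>Tr (x \<zeta>\<^sup>j)\<close>, so only finitely many
  differences are short.
\<close>

section \<open>Relative density on the line and in the plane\<close>

text \<open>Induction on the scale g = \<open>l ^ k / 2\<close>, with half-length L around 1/2. One
  combination \<open>(1 - l) * d' + l * d\<close> turns g into \<open>l * g\<close> and L into
  \<open>(2 * l - 1) * L - (l - 1) * g\<close>; the loss is the error of \<open>d'\<close> amplified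
  by \<open>l - 1\<close>. The stated half-length solves this recursion with L = 1 at k = 0.\<close>

lemma lambda_closed_cover:
  fixes T :: "real set" and l t :: real
  assumes l: "l > 1" and T: "0 \<in> T" "1 \<in> T"
    and closed: "\<And>a b. a \<in> T \<Longrightarrow> b \<in> T \<Longrightarrow> (1 - l) * a + l * b \<in> T"
    and t: "\<bar>t - 1/2\<bar> \<le> (l ^ k + (2 * l - 1) ^ k) / 2"
  shows "\<exists>d\<in>T. \<bar>t - d\<bar> \<le> l ^ k / 2"
  using t
proof (induction k arbitrary: t)
  case 0
  have "\<bar>t - 1/2\<bar> \<le> 1" using 0 by simp
  then have "\<bar>t - 0\<bar> \<le> 1/2 \<or> \<bar>t - 1\<bar> \<le> 1/2" by (auto simp: abs_if split: if_splits)
  then show ?case using T unfolding power_0 by blast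
next
  case (Suc k)
  define g where "g = l ^ k / 2"
  define L where "L = (l ^ k + (2 * l - 1) ^ k) / 2"
  define s where "s = t - 1/2"
  have g: "g > 0" and gL: "g \<le> L" using l by (auto simp: g_def L_def)
  have "(l ^ Suc k + (2 * l - 1) ^ Suc k) / 2 = (2 * l - 1) * L - (l - 1) * g"
    by (simp add: L_def g_def field_simps)
  then have s: "\<bar>s\<bar> \<le> (2 * l - 1) * L - (l - 1) * g"
    using Suc.prems by (simp add: s_def)
  have pos: "(l - 1) * g \<le> (l - 1) * L" "(l - 1) * L > 0" "L > 0" "(l - 1) * g > 0"
    using g gL l by auto
  \<comment> \<open>The offset \<open>s\<close> is split: \<open>(1 - l) * d'\<close> can absorb a
    \<open>y\<close> of size up to \<open>(l - 1) * L\<close>, and \<open>l * d\<close> takes the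
    rest, with \<open>(l - 1) * g\<close> held back for the error of \<open>d'\<close>.\<close>
  have "\<exists>y. \<bar>y\<bar> \<le> (l - 1) * L \<and> \<bar>s - y\<bar> \<le> l * L - (l - 1) * g"
  proof (cases "\<bar>s\<bar> \<le> (l - 1) * L")
    case True
    then show ?thesis using pos by (intro exI[of _ s]) (auto simp: algebra_simps)
  next
    case False
    then show ?thesis using pos s
      by (intro exI[of _ "if s > 0 then (l - 1) * L else - ((l - 1) * L)"])
         (auto simp: algebra_simps abs_if split: if_splits)
  qed
  then obtain y where y: "\<bar>y\<bar> \<le> (l - 1) * L" "\<bar>s - y\<bar> \<le> l * L - (l - 1) * g" by blast
  have "\<bar>y / (l - 1)\<bar> \<le> L"
    using y(1) l by (simp add: field_simps abs_if split: if_splits)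
  then have "\<bar>(1/2 - y / (l - 1)) - 1/2\<bar> \<le> L" by (simp add: abs_if split: if_splits)
  then obtain d' where d': "d' \<in> T" "\<bar>1/2 - y / (l - 1) - d'\<bar> \<le> g"
    using Suc.IH unfolding L_def g_def by blast
  define e where "e = d' - 1/2 + y / (l - 1)"
  have e: "\<bar>e\<bar> \<le> g" using d'(2) by (simp add: e_def abs_if split: if_splits)
  define x where "x = (t - (1 - l) * d') / l"
  have "l * (x - 1/2) = s - y + (l - 1) * e"
    using l by (simp add: x_def e_def s_def field_simps)
  moreover have "\<bar>(l - 1) * e\<bar> \<le> (l - 1) * g"
    using e l by (simp add: abs_mult)
  ultimately have "\<bar>l * (x - 1/2)\<bar> \<le> l * L" using y(2) by linarith
  then have "\<bar>x - 1/2\<bar> \<le> L" using l by (simp add: abs_mult)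
  then obtain d where d: "d \<in> T" "\<bar>x - d\<bar> \<le> g"
    using Suc.IH unfolding L_def g_def by blast
  have "t - ((1 - l) * d' + l * d) = l * (x - d)" using l by (simp add: x_def field_simps)
  then have "\<bar>t - ((1 - l) * d' + l * d)\<bar> \<le> l * g" using d(2) l by (simp add: abs_mult)
  then show ?case using closed[OF d'(1) d(1)] by (auto simp: g_def)
qed

lemma lambda_closed_relatively_dense:
  fixes T :: "real set" and l :: real
  assumes l: "l > 1" and T: "0 \<in> T" "1 \<in> T"
    and closed: "\<And>a b. a \<in> T \<Longrightarrow> b \<in> T \<Longrightarrow> (1 - l) * a + l * b \<in> T"
  obtains R where "R > 0" "\<And>t. \<exists>d\<in>T. \<bar>t - d\<bar> \<le> R"
proof -
  \<comment> \<open>The base exceeds 1 because \<open>l > 1\<close>. This \<open>k\<close> makes the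
    half-length at least \<open>(l + 1) * g\<close>: radius \<open>l * g\<close> for the growth
    argument below, plus \<open>g\<close> for moving the centre from 1/2 to a point \<open>c\<close>
    of \<open>T\<close>.\<close>
  obtain k where k: "l < ((2 * l - 1) / l) ^ k"
    using l real_arch_pow[of "(2 * l - 1) / l" l] by (auto simp: field_simps)
  define g where "g = l ^ k / 2"
  have g: "g > 0" using l by (simp add: g_def)
  have "l * l ^ k \<le> (2 * l - 1) ^ k"
    using k l by (simp add: power_divide field_simps)
  then have L: "(l + 1) * g \<le> (l ^ k + (2 * l - 1) ^ k) / 2"
    by (simp add: g_def field_simps)
  have cover: "\<exists>d\<in>T. \<bar>t - d\<bar> \<le> g" if "\<bar>t - 1/2\<bar> \<le> (l + 1) * g" for t
    using lambda_closed_cover[OF l T closed, of t k] that L by (auto simp: g_def)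
  obtain c where c: "c \<in> T" "\<bar>1/2 - c\<bar> \<le> g" using cover[of "1/2"] g l by auto
  have cover': "\<exists>d\<in>T. \<bar>t - d\<bar> \<le> g" if "\<bar>t - c\<bar> \<le> l * g" for t
    using that c by (intro cover) (auto simp: algebra_simps abs_if split: if_splits)
  have growing: "\<exists>d\<in>T. \<bar>t - d\<bar> \<le> (l - 1) * g" if "\<bar>t - c\<bar> \<le> l ^ j * ((l - 1) * g)" for j t
    using that
  proof (induction j arbitrary: t)
    case 0
    then show ?case using c by auto
  next
    case (Suc j)
    \<comment> \<open>Contracting \<open>t\<close> towards \<open>c\<close> brings it into reach of
      the induction hypothesis; expanding again by \<open>l\<close> magnifies the error to at most
      \<open>l * (l - 1) * g\<close>. The centre \<open>u\<close> would cancel this error exactly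
      and lies within \<open>l * g\<close> of \<open>c\<close>, where \<open>T\<close> is g-dense.
      Replacing \<open>u\<close> by \<open>a\<close> in \<open>T\<close> costs
      \<open>(l - 1) * g\<close>, whatever \<open>j\<close> is.\<close>
    define t' where "t' = c + (t - c) / l"
    have "\<bar>t' - c\<bar> = \<bar>t - c\<bar> / l" using l by (simp add: t'_def)
    also have "\<dots> \<le> l ^ j * ((l - 1) * g)" using Suc.prems l by (simp add: field_simps)
    finally obtain d' where d': "d' \<in> T" "\<bar>t' - d'\<bar> \<le> (l - 1) * g" using Suc.IH by blast
    define u where "u = c - l * (t' - d') / (l - 1)"
    have "\<bar>u - c\<bar> = l * (\<bar>t' - d'\<bar> / (l - 1))" using l by (simp add: u_def abs_mult)
    also have "\<dots> \<le> l * g"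
      using d'(2) l by (intro mult_left_mono) (simp_all add: pos_divide_le_eq mult.commute)
    finally obtain a where a: "a \<in> T" "\<bar>u - a\<bar> \<le> g" using cover' by blast
    have "t - ((1 - l) * a + l * d') = (l - 1) * (a - u)"
      using l by (simp add: u_def t'_def field_simps)
    then have "\<bar>t - ((1 - l) * a + l * d')\<bar> \<le> (l - 1) * g"
      using a(2) l by (simp add: abs_mult abs_minus_commute)
    then show ?case using closed[OF a(1) d'(1)] by blast
  qed
  show thesis
  proof (rule that)
    show pos: "(l - 1) * g > 0" using l g by simp
    show "\<exists>d\<in>T. \<bar>t - d\<bar> \<le> (l - 1) * g" for t
    proof -
      obtain j where "\<bar>t - c\<bar> / ((l - 1) * g) < l ^ j" using real_arch_pow[OF l] by blast
      then have "\<bar>t - c\<bar> \<le> l ^ j * ((l - 1) * g)"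
        using pos l g by (simp add: pos_divide_less_eq)
      then show ?thesis by (rule growing)
    qed
  qed
qed

lemma lambda_convex_relatively_dense:
  fixes l :: real
  assumes l: "l > 1" and A: "lambda_convex (complex_of_real l) A"
    and mem: "0 \<in> A" "1 \<in> A" "w \<in> A" and w: "Im w \<noteq> 0"
  shows "relatively_dense A"
proof -
  \<comment> \<open>\<open>T\<close> collects the real multipliers under which \<open>A\<close> is
    closed. An \<open>l\<close>-combination of an \<open>x\<close>-combination and a
    \<open>y\<close>-combination of \<open>a\<close> and \<open>b\<close> is again a combination of
    \<open>a\<close> and \<open>b\<close>, so \<open>T\<close> inherits closure and the result on
    the line applies to it.\<close>
  define T where "T = {x::real. \<forall>a\<in>A. \<forall>b\<in>A. (1 - complex_of_real x) * a + of_real x * b \<in> A}"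
  have "(1 - l) * x + l * y \<in> T" if "x \<in> T" "y \<in> T" for x y
  proof -
    have "(1 - complex_of_real ((1 - l) * x + l * y)) * a + of_real ((1 - l) * x + l * y) * b \<in> A"
      if "a \<in> A" "b \<in> A" for a b
    proof -
      have "(1 - complex_of_real ((1 - l) * x + l * y)) * a + of_real ((1 - l) * x + l * y) * b
          = (1 - of_real l) * ((1 - of_real x) * a + of_real x * b)
            + of_real l * ((1 - of_real y) * a + of_real y * b)"
        by (simp add: algebra_simps)
      also have "\<dots> \<in> A"
        using A \<open>x \<in> T\<close> \<open>y \<in> T\<close> that unfolding lambda_convex_def T_def by blast
      finally show ?thesis .
    qed
    then show ?thesis unfolding T_def by blast
  qed
  moreover have "0 \<in> T" "1 \<in> T" by (auto simp: T_def)
  ultimately obtain R where R: "R > 0" "\<And>t. \<exists>d\<in>T. \<bar>t - d\<bar> \<le> R"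
    using lambda_closed_relatively_dense[OF l] by metis
  define r where "r = l * R + (l - 1) * R * norm w + 1"
  have "\<exists>a\<in>A. dist a z < r" for z
  proof -
    define \<beta> where "\<beta> = Im z / Im w"
    define \<alpha> where "\<alpha> = Re z - \<beta> * Re w"
    have z: "z = of_real \<alpha> + of_real \<beta> * w"
      using w by (simp add: complex_eq_iff \<alpha>_def \<beta>_def)
    \<comment> \<open>The final combination multiplies \<open>\<mu>\<close> by \<open>l\<close> and
      \<open>\<nu> * w\<close> by \<open>1 - l\<close>, hence the rescaled targets.\<close>
    obtain \<mu> where \<mu>: "\<mu> \<in> T" "\<bar>\<alpha> / l - \<mu>\<bar> \<le> R" using R(2) by blast
    obtain \<nu> where \<nu>: "\<nu> \<in> T" "\<bar>\<beta> / (1 - l) - \<nu>\<bar> \<le> R" using R(2) by blast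
    have "of_real \<mu> \<in> A" using \<mu>(1) mem unfolding T_def by force
    moreover have "of_real \<nu> * w \<in> A" using \<nu>(1) mem unfolding T_def by force
    ultimately have a: "(1 - of_real l) * (of_real \<nu> * w) + of_real l * of_real \<mu> \<in> A"
      using A unfolding lambda_convex_def by blast
    have "z - ((1 - of_real l) * (of_real \<nu> * w) + of_real l * of_real \<mu>)
        = of_real (l * (\<alpha> / l - \<mu>)) + of_real ((1 - l) * (\<beta> / (1 - l) - \<nu>)) * w"
      using l unfolding z by (simp add: field_simps)
    also have "norm \<dots> \<le> \<bar>l * (\<alpha> / l - \<mu>)\<bar> + \<bar>(1 - l) * (\<beta> / (1 - l) - \<nu>)\<bar> * norm w"
      by (rule norm_triangle_le) (simp only: norm_mult norm_of_real)
    also have "\<dots> \<le> l * R + ((l - 1) * R) * norm w"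
      using l \<mu>(2) \<nu>(2) unfolding abs_mult by (intro add_mono mult_right_mono mult_mono) auto
    also have "\<dots> < r" by (simp add: r_def)
    finally show ?thesis using a by (auto simp: dist_norm norm_minus_commute)
  qed
  moreover have "r > 0" using l R(1) by (simp add: r_def add_nonneg_pos)
  ultimately show ?thesis unfolding relatively_dense_def by (auto intro!: exI[of _ r])
qed

lemma P_members:
  assumes "n \<ge> 3"
  shows "0 \<in> P n" "1 \<in> P n" "1 + cis (2 * pi / n) \<in> P n"
  using assms unfolding P_def
  by (auto intro: exI[of _ 0] exI[of _ 1] exI[of _ 2] simp: eval_nat_numeral)

lemma relatively_dense_Q_P:
  fixes l :: real
  assumes "l > 1" "n \<ge> 3"
  shows "relatively_dense (Q (complex_of_real l) (P n))"
proof (rule lambda_convex_relatively_dense[OF assms(1) lambda_convex_Q])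
  show "0 \<in> Q l (P n)" "1 \<in> Q l (P n)" "1 + cis (2 * pi / n) \<in> Q l (P n)"
    using P_members[OF assms(2)] subset_Q by auto
  have "sin (2 * pi / n) > 0" using assms(2) by (intro sin_gt_zero) (auto simp: field_simps)
  then show "Im (1 + cis (2 * pi / n)) \<noteq> 0" by simp
qed

section \<open>Integer polynomials at roots of unity; finiteness from bounded conjugates\<close>

abbreviation unity_root :: "nat \<Rightarrow> complex" where
  "unity_root n \<equiv> cis (2 * pi / real n)"

lemma unity_root_power_eq_1_iff:
  assumes "n > 0"
  shows "unity_root n ^ i = 1 \<longleftrightarrow> n dvd i"
proof
  assume "unity_root n ^ i = 1"
  then have "Re (cis (real i * (2 * pi / n))) = 1"
    by (simp only: Complex.DeMoivre one_complex.sel)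
  then have "cos (real i * (2 * pi / n)) = 1" by (simp only: cis.sel)
  then obtain m :: int where "real i * (2 * pi / n) = m * 2 * pi"
    by (auto simp: cos_one_2pi_int)
  then have "real i = of_int m * real n" using assms by (simp add: field_simps)
  then have "int i = m * int n" by (metis of_int_eq_iff of_int_mult of_int_of_nat_eq)
  then show "n dvd i" by (metis dvd_triv_right int_dvd_int_iff)
next
  assume "n dvd i"
  then obtain m where "i = n * m" by blast
  then show "unity_root n ^ i = 1" using assms by (simp add: power_mult Complex.DeMoivre)
qed

lemma sum_unity_root_powers:
  assumes "n > 0"
  shows "(\<Sum>k<n. (unity_root n ^ k) ^ i) = (if n dvd i then of_nat n else 0)"
proof -
  have *: "(\<Sum>k<n. (unity_root n ^ k) ^ i) = (\<Sum>k<n. (unity_root n ^ i) ^ k)"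
    by (simp add: power_mult[symmetric] mult.commute)
  have "(unity_root n ^ i) ^ n = 1"
    using assms unity_root_power_eq_1_iff[of n "i * n"] by (simp add: power_mult)
  then show ?thesis
    unfolding * using unity_root_power_eq_1_iff[OF assms, of i]
    by (auto simp: geometric_sum)
qed

text \<open>An element of \<int>[\<zeta>] is carried by a polynomial whose value at \<zeta> it is.
  Its conjugates are then read off as values at powers of \<zeta>, without field
  automorphisms.\<close>

definition int_coeffs :: "complex poly \<Rightarrow> bool" where
  "int_coeffs p \<longleftrightarrow> (\<forall>i. coeff p i \<in> \<int>)"

lemma int_coeffs_add: "int_coeffs p \<Longrightarrow> int_coeffs q \<Longrightarrow> int_coeffs (p + q)"
  and int_coeffs_diff: "int_coeffs p \<Longrightarrow> int_coeffs q \<Longrightarrow> int_coeffs (p - q)"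
  and int_coeffs_mult: "int_coeffs p \<Longrightarrow> int_coeffs q \<Longrightarrow> int_coeffs (p * q)"
  and int_coeffs_monom: "c \<in> \<int> \<Longrightarrow> int_coeffs (monom c m)"
  by (auto simp: int_coeffs_def coeff_mult)

lemma int_coeffs_sum: "(\<And>i. i \<in> I \<Longrightarrow> int_coeffs (f i)) \<Longrightarrow> int_coeffs (sum f I)"
  by (auto simp: int_coeffs_def coeff_sum)

lemma int_coeffs_const: "c \<in> \<int> \<Longrightarrow> int_coeffs [:c:]"
  using int_coeffs_monom[of c 0] by (simp add: monom_0)

lemma int_coeffs_prod: "(\<And>i. i \<in> I \<Longrightarrow> int_coeffs (f i)) \<Longrightarrow> int_coeffs (prod f I)"
  by (induction I rule: infinite_finite_induct)
     (auto simp: int_coeffs_mult int_coeffs_const[of 1, simplified one_pCons[symmetric]])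

lemma int_coeffs_poly_cnj:
  assumes "int_coeffs p"
  shows "poly p (cnj z) = cnj (poly p z)"
proof -
  have "cnj (coeff p i) = coeff p i" for i
    using assms unfolding int_coeffs_def by (metis Ints_cases complex_cnj_of_int)
  then show ?thesis by (simp add: poly_altdef)
qed

text \<open>After interchanging the sums only power sums of the roots of unity remain, and these are
  0 or \<open>n\<close>.\<close>

lemma sum_int_coeffs_unity_roots:
  assumes "n > 0" "int_coeffs p"
  shows "(\<Sum>k<n. poly p (unity_root n ^ k)) \<in> \<int>"
proof -
  have "(\<Sum>k<n. poly p (unity_root n ^ k))
      = (\<Sum>i\<le>degree p. coeff p i * (\<Sum>k<n. (unity_root n ^ k) ^ i))"
    unfolding poly_altdef sum_distrib_left by (rule sum.swap)
  also have "\<dots> \<in> \<int>"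
    using assms(2) unfolding sum_unity_root_powers[OF assms(1)] int_coeffs_def
    by (intro Ints_sum Ints_mult) auto
  finally show ?thesis .
qed

text \<open>At an \<open>n\<close>-th root of unity \<open>z\<close> the factor for \<open>p\<close> is \<open>p\<close> or \<open>0\<close>, according to whether
  \<open>z\<^bsup>n/p\<^esup> \<noteq> 1\<close>. Multiplying by it cuts a sum over all roots of unity down to a multiple of the trace,
  which avoids cyclotomic polynomials.\<close>

definition coprime_selector :: "nat \<Rightarrow> complex poly" where
  "coprime_selector n =
    (\<Prod>p\<in>prime_factors n. [:of_nat p:] - (\<Sum>j<p. monom 1 (j * (n div p))))"

lemma int_coeffs_coprime_selector: "int_coeffs (coprime_selector n)"
  unfolding coprime_selector_def
  by (intro int_coeffs_prod int_coeffs_diff int_coeffs_sum int_coeffs_monom int_coeffs_const) auto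

lemma poly_coprime_selector:
  assumes "n > 0"
  shows "poly (coprime_selector n) (unity_root n ^ k)
    = (if coprime k n then of_nat (\<Prod>(prime_factors n)) else 0)"
proof -
  have factor: "poly ([:of_nat p:] - (\<Sum>j<p. monom 1 (j * (n div p)))) (unity_root n ^ k)
      = (if p dvd k then 0 else of_nat p)" if "p \<in> prime_factors n" for p
  proof -
    have p: "p > 0" "p dvd n" using that by (auto simp: in_prime_factors_iff prime_gt_0_nat)
    have "real (n div p) * (2 * pi / n) = 2 * pi / p"
      using p assms by (simp add: real_of_nat_div field_simps)
    then have root: "unity_root n ^ (n div p) = unity_root p" by (simp only: Complex.DeMoivre)
    \<comment> \<open>This is the power sum of the p-th roots of unity with exponent
      \<open>k\<close>, equal to \<open>p\<close> or 0; subtracting it from \<open>p\<close> gives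
      the factor.\<close>
    have "(\<Sum>j<p. (unity_root n ^ k) ^ (j * (n div p))) = (\<Sum>j<p. (unity_root p ^ j) ^ k)"
      unfolding root[symmetric]
      by (intro sum.cong refl) (simp add: power_mult[symmetric] ac_simps)
    then show ?thesis
      using p by (simp add: poly_sum poly_monom sum_unity_root_powers)
  qed
  have "poly (coprime_selector n) (unity_root n ^ k)
      = (\<Prod>p\<in>prime_factors n. if p dvd k then 0 else of_nat p)"
    unfolding coprime_selector_def poly_prod by (rule prod.cong[OF refl factor])
  moreover have "coprime k n \<longleftrightarrow> (\<forall>p\<in>prime_factors n. \<not> p dvd k)"
  proof
    show "coprime k n \<Longrightarrow> \<forall>p\<in>prime_factors n. \<not> p dvd k"
      by (meson coprime_common_divisor in_prime_factors_iff not_prime_unit)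
    show "\<forall>p\<in>prime_factors n. \<not> p dvd k \<Longrightarrow> coprime k n"
      using assms by (metis coprime_iff_gcd_eq_1 gcd_nat.bounded_iff in_prime_factors_iff
          not_gr_zero prime_factor_nat)
  qed
  ultimately show ?thesis by (auto simp: prod_zero_iff)
qed

text \<open>The selected values \<open>v k\<close> have Fourier coefficients \<open>t j\<close> that
  are integers of norm at most \<open>n * (B * M)\<close>. Only finitely many tuples
  \<open>t\<close> arise, and Fourier inversion recovers the number from its tuple.\<close>

lemma finite_bounded_conjugates:
  assumes n: "n \<ge> 2"
  shows "finite {poly p (unity_root n) | p. int_coeffs p \<and>
    (\<forall>k<n. coprime k n \<longrightarrow> norm (poly p (unity_root n ^ k)) \<le> B)}" (is "finite ?Z")
proof -
  define M where "M = \<Prod>(prime_factors n)"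
  have M: "M > 0" unfolding M_def by (auto intro!: prod_pos simp: in_prime_factors_iff prime_gt_0_nat)
  define I where "I = {x::complex. x \<in> \<int> \<and> norm x \<le> n * (B * M)}"
  have "I \<subseteq> of_int ` {- \<lceil>n * (B * M)\<rceil>..\<lceil>n * (B * M)\<rceil>}"
  proof
    fix x assume x: "x \<in> I"
    then obtain m where m: "x = of_int m" unfolding I_def by (auto elim: Ints_cases)
    have "\<bar>real_of_int m\<bar> \<le> n * (B * M)" using x m by (simp add: I_def)
    then have "m \<in> {- \<lceil>n * (B * M)\<rceil>..\<lceil>n * (B * M)\<rceil>}"
      unfolding atLeastAtMost_iff by linarith
    then show "x \<in> of_int ` {- \<lceil>n * (B * M)\<rceil>..\<lceil>n * (B * M)\<rceil>}" using m by blast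
  qed
  then have I: "finite I" by (rule finite_subset) simp
  \<comment> \<open>Fourier inversion at index 1: the exponent \<open>n - 1\<close> serves as -1,
    and \<open>M\<close> is the value of the selector there.\<close>
  have "?Z \<subseteq> (\<lambda>t. (\<Sum>j<n. t j * unity_root n ^ (j * (n - 1))) / of_nat (n * M)) ` (\<Pi>\<^sub>E j\<in>{..<n}. I)"
  proof
    fix z assume "z \<in> ?Z"
    then obtain p where p: "int_coeffs p" "z = poly p (unity_root n)"
      and B: "\<And>k. k < n \<Longrightarrow> coprime k n \<Longrightarrow> norm (poly p (unity_root n ^ k)) \<le> B" by blast
    define v where "v k = poly p (unity_root n ^ k) * poly (coprime_selector n) (unity_root n ^ k)" for k
    define t where "t j = (\<Sum>k<n. v k * (unity_root n ^ k) ^ j)" for j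
    \<comment> \<open>The bound \<open>B * M\<close> must also cover the indices where the selector
      vanishes, so \<open>B\<close> has to be nonnegative; index 1 shows this.\<close>
    have "B \<ge> 0" using order_trans[OF norm_ge_zero B[of 1]] n by simp
    then have "norm (v k) \<le> B * M" if "k < n" for k
      using n B[OF that] unfolding v_def M_def
      by (auto simp: poly_coprime_selector norm_mult simp del: of_nat_prod intro!: mult_right_mono)
    then have "norm (t j) \<le> (\<Sum>k<n. B * M)" for j
      unfolding t_def by (intro sum_norm_le) (simp add: norm_mult norm_power)
    moreover have "t j \<in> \<int>" for j
    proof -
      have "t j = (\<Sum>k<n. poly (p * coprime_selector n * monom 1 j) (unity_root n ^ k))"
        by (simp add: t_def v_def poly_monom)
      also have "\<dots> \<in> \<int>" using n p(1)
        by (intro sum_int_coeffs_unity_roots int_coeffs_mult int_coeffs_coprime_selector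
            int_coeffs_monom) auto
      finally show ?thesis .
    qed
    ultimately have tI: "restrict t {..<n} \<in> (\<Pi>\<^sub>E j\<in>{..<n}. I)" by (auto simp: I_def)
    have "(\<Sum>j<n. t j * unity_root n ^ (j * (n - 1)))
        = (\<Sum>k<n. v k * (\<Sum>j<n. (unity_root n ^ j) ^ (k + (n - 1))))"
      unfolding t_def sum_distrib_left sum_distrib_right
      by (subst sum.swap) (simp add: power_mult[symmetric] power_add[symmetric] algebra_simps)
    also have "\<dots> = (\<Sum>k<n. if k = 1 then v k * of_nat n else 0)"
    proof (rule sum.cong[OF refl])
      fix k assume "k \<in> {..<n}"
      then have "n dvd k + (n - 1) \<longleftrightarrow> k = 1"
        using n by (cases k) (auto dest: dvd_imp_le)
      then show "v k * (\<Sum>j<n. (unity_root n ^ j) ^ (k + (n - 1))) = (if k = 1 then v k * of_nat n else 0)"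
        using n by (simp add: sum_unity_root_powers)
    qed
    also have "\<dots> = v 1 * of_nat n" using n by simp
    also have "v 1 = z * of_nat M"
      using n poly_coprime_selector[of n 1] by (simp add: v_def p(2) M_def)
    finally have "z = (\<Sum>j<n. t j * unity_root n ^ (j * (n - 1))) / of_nat (n * M)"
      using n M by simp
    then show "z \<in> (\<lambda>t. (\<Sum>j<n. t j * unity_root n ^ (j * (n - 1))) / of_nat (n * M)) ` (\<Pi>\<^sub>E j\<in>{..<n}. I)"
      using tI by (intro image_eqI[of _ _ "restrict t {..<n}"]) auto
  qed
  then show ?thesis using I by (meson finite_PiE finite_imageI finite_lessThan finite_subset)
qed


section \<open>Uniformly discrete differences and a Meyer criterion\<close>

text \<open>Expresses complex conjugation by a power, hence within integer polynomials: it settles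
  the index \<open>n - 1\<close> and makes the multipliers below real at every power of \<zeta>
  considered.\<close>

lemma unity_root_power_pred:
  assumes "n > 0"
  shows "(unity_root n ^ k) ^ (n - 1) = cnj (unity_root n ^ k)"
proof -
  have "cnj (unity_root n ^ k) = cnj (unity_root n ^ k) * (unity_root n ^ k) ^ n"
    using unity_root_power_eq_1_iff[of n "k * n"] assms by (simp add: power_mult)
  also have "\<dots> = (unity_root n ^ k) ^ (n - 1) * (cnj (unity_root n ^ k) * unity_root n ^ k)"
    using assms by (simp add: power_eq_if[of _ n] mult_ac)
  also have "cnj (unity_root n ^ k) * unity_root n ^ k = 1"
    by (subst mult.commute) (simp add: complex_norm_square[symmetric] norm_power del: complex_cnj_power)
  finally show ?thesis by simp
qed

text \<open>A bound at the indices other than 1 and \<open>n - 1\<close> survives the hull, because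
  there an \<open>l\<close>-combination becomes a true convex combination. If two differences are
  close, their difference is also small at 1 and \<open>n - 1\<close>; it then lies in a finite set
  whose nonzero elements stay away from 0.\<close>

lemma uniform_discrete_diff_Q:
  fixes l :: real
  assumes n: "n \<ge> 2" and S: "finite S" "S \<subseteq> {poly p (unity_root n) | p. int_coeffs p}"
    and q: "int_coeffs q" "poly q (unity_root n) = of_real l"
    and conj: "\<And>k. k < n \<Longrightarrow> coprime k n \<Longrightarrow> k \<noteq> 1 \<Longrightarrow> k \<noteq> n - 1 \<Longrightarrow>
      \<exists>c::real. 0 \<le> c \<and> c \<le> 1 \<and> poly q (unity_root n ^ k) = of_real c"
  shows "uniform_discrete {x - y | x y. x \<in> Q (of_real l) S \<and> y \<in> Q (of_real l) S}"
proof -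
  obtain f where f: "\<And>s. s \<in> S \<Longrightarrow> int_coeffs (f s)" "\<And>s. s \<in> S \<Longrightarrow> s = poly (f s) (unity_root n)"
    using S(2) by (simp add: subset_iff) metis
  \<comment> \<open>Summing over all of \<open>S\<close> and all \<open>k\<close> gives one constant
    above every single value.\<close>
  define C where "C = (\<Sum>s\<in>S. \<Sum>k<n. norm (poly (f s) (unity_root n ^ k)))"
  define bounded_at where "bounded_at c p \<longleftrightarrow> (\<forall>k<n. coprime k n \<and> k \<noteq> 1 \<and> k \<noteq> n - 1 \<longrightarrow>
    norm (poly p (unity_root n ^ k)) \<le> c)" for c p
  define A where "A = {poly p (unity_root n) | p. int_coeffs p \<and> bounded_at C p}"
  have "bounded_at C (f s)" if "s \<in> S" for s
  proof -
    have "norm (poly (f s) (unity_root n ^ k)) \<le> C" if "k < n" for k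
    proof -
      have "norm (poly (f s) (unity_root n ^ k)) \<le> (\<Sum>k<n. norm (poly (f s) (unity_root n ^ k)))"
        using that by (intro member_le_sum) auto
      also have "\<dots> \<le> C"
        unfolding C_def using \<open>s \<in> S\<close> S(1)
        by (intro member_le_sum[of s S "\<lambda>s. \<Sum>k<n. norm (poly (f s) (unity_root n ^ k))"])
           (auto intro: sum_nonneg)
      finally show ?thesis .
    qed
    then show ?thesis by (simp add: bounded_at_def)
  qed
  then have "S \<subseteq> A" unfolding A_def using f by blast
  moreover have "lambda_convex (of_real l) A"
    unfolding lambda_convex_def
  proof (intro ballI)
    fix a b assume "a \<in> A" "b \<in> A"
    then obtain p r where p: "int_coeffs p" "bounded_at C p" "a = poly p (unity_root n)"
      and r: "int_coeffs r" "bounded_at C r" "b = poly r (unity_root n)"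
      unfolding A_def by blast
    define m where "m = ([:1:] - q) * p + q * r"
    have "int_coeffs m"
      unfolding m_def using p(1) r(1) q(1)
      by (intro int_coeffs_add int_coeffs_mult int_coeffs_diff int_coeffs_const) auto
    moreover have "bounded_at C m"
      unfolding bounded_at_def
    proof (intro allI impI)
      fix k assume k: "k < n" "coprime k n \<and> k \<noteq> 1 \<and> k \<noteq> n - 1"
      then obtain c :: real where c: "0 \<le> c" "c \<le> 1" "poly q (unity_root n ^ k) = of_real c"
        using conj by blast
      have "norm (poly m (unity_root n ^ k)) \<le> (1 - c) * norm (poly p (unity_root n ^ k))
          + c * norm (poly r (unity_root n ^ k))"
        using norm_triangle_ineq[of "of_real (1 - c) * poly p (unity_root n ^ k)"
            "of_real c * poly r (unity_root n ^ k)"] c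
        unfolding norm_mult norm_of_real by (simp add: m_def)
      also have "\<dots> \<le> (1 - c) * C + c * C"
        using p(2) r(2) k c unfolding bounded_at_def by (intro add_mono mult_left_mono) auto
      finally show "norm (poly m (unity_root n ^ k)) \<le> C" by (simp add: algebra_simps)
    qed
    moreover have "(1 - of_real l) * a + of_real l * b = poly m (unity_root n)"
      using p(3) r(3) q(2) by (simp add: m_def)
    ultimately show "(1 - of_real l) * a + of_real l * b \<in> A" unfolding A_def by blast
  qed
  ultimately have QA: "Q (of_real l) S \<subseteq> A" by (rule Q_minimal)
  \<comment> \<open>\<open>4 * C\<close> covers a difference of two differences of elements of
    \<open>A\<close>; 1 covers the indices 1 and \<open>n - 1\<close>, where closeness below
    \<open>min e 1\<close> is used.\<close>
  define Z where "Z = {poly p (unity_root n) | p. int_coeffs p \<and>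
    (\<forall>k<n. coprime k n \<longrightarrow> norm (poly p (unity_root n ^ k)) \<le> max 1 (4 * C))}"
  have "finite Z" unfolding Z_def by (rule finite_bounded_conjugates[OF n])
  then obtain e where e: "e > 0" "\<And>z. z \<in> Z \<Longrightarrow> z \<noteq> 0 \<Longrightarrow> e \<le> norm z"
    using finite_set_avoid[of Z 0] by auto
  have "x - y = x' - y'"
    if mem: "x \<in> A" "y \<in> A" "x' \<in> A" "y' \<in> A" and close: "dist (x - y) (x' - y') < min e 1"
    for x y x' y'
  proof -
    obtain p1 p2 p3 p4 where p: "int_coeffs p1" "bounded_at C p1" "x = poly p1 (unity_root n)"
      "int_coeffs p2" "bounded_at C p2" "y = poly p2 (unity_root n)"
      "int_coeffs p3" "bounded_at C p3" "x' = poly p3 (unity_root n)"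
      "int_coeffs p4" "bounded_at C p4" "y' = poly p4 (unity_root n)"
      using mem unfolding A_def by blast
    define d where "d = (p1 - p2) - (p3 - p4)"
    have d: "int_coeffs d" unfolding d_def using p by (intro int_coeffs_diff)
    have val: "poly d (unity_root n) = (x - y) - (x' - y')" using p by (simp add: d_def)
    have "norm (poly d (unity_root n ^ k)) \<le> max 1 (4 * C)" if k: "k < n" "coprime k n" for k
    proof -
      consider "k = 1" | "k = n - 1" | "k \<noteq> 1" "k \<noteq> n - 1" by blast
      then show ?thesis
      proof cases
        case 1
        then show ?thesis using close val by (simp add: dist_norm less_imp_le le_max_iff_disj)
      next
        case 2
        have "poly d (unity_root n ^ k) = cnj (poly d (unity_root n))"
          using unity_root_power_pred[of n 1] n 2 int_coeffs_poly_cnj[OF d, of "unity_root n"]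
          by simp
        then have "norm (poly d (unity_root n ^ k)) = norm (poly d (unity_root n))"
          by (simp only: complex_mod_cnj)
        then show ?thesis using close val by (simp add: dist_norm less_imp_le le_max_iff_disj)
      next
        case 3
        then have "norm (poly p1 (unity_root n ^ k)) \<le> C" "norm (poly p2 (unity_root n ^ k)) \<le> C"
          "norm (poly p3 (unity_root n ^ k)) \<le> C" "norm (poly p4 (unity_root n ^ k)) \<le> C"
          using p k unfolding bounded_at_def by blast+
        then have "norm (poly p1 (unity_root n ^ k) - poly p2 (unity_root n ^ k)) \<le> C + C"
          "norm (poly p3 (unity_root n ^ k) - poly p4 (unity_root n ^ k)) \<le> C + C"
          by (meson add_mono norm_triangle_le_diff)+
        then have "norm (poly d (unity_root n ^ k)) \<le> (C + C) + (C + C)"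
          unfolding d_def poly_diff by (meson add_mono norm_triangle_le_diff)
        then show ?thesis by simp
      qed
    qed
    then have "(x - y) - (x' - y') \<in> Z" unfolding Z_def val[symmetric] using d by blast
    then show ?thesis using e(2) close by (force simp: dist_norm)
  qed
  then show ?thesis
    unfolding uniform_discrete_def using QA e(1)
    by (intro exI[of _ "min e 1"]) (simp add: subset_iff, blast)
qed


lemma int_coeffs_power: "int_coeffs p \<Longrightarrow> int_coeffs (p ^ m)"
  by (induction m) (auto simp: int_coeffs_mult int_coeffs_const[of 1, simplified one_pCons[symmetric]])

text \<open>The polygon index \<open>m\<close> is kept apart from the index \<open>n\<close> of the
  ring, so that for odd \<open>n\<close> the 2n-gon can be treated in the ring of the n-gon.\<close>

lemma meyer_set_Q_P:
  fixes l :: real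
  assumes n: "n \<ge> 2" and m: "m \<ge> 3" and l: "l > 1"
    and r: "int_coeffs r" "unity_root m = poly r (unity_root n)"
    and q: "int_coeffs q" "poly q (unity_root n) = of_real l"
    and conj: "\<And>k. k < n \<Longrightarrow> coprime k n \<Longrightarrow> k \<noteq> 1 \<Longrightarrow> k \<noteq> n - 1 \<Longrightarrow>
      \<exists>c::real. 0 \<le> c \<and> c \<le> 1 \<and> poly q (unity_root n ^ k) = of_real c"
  shows "meyer_set (Q (of_real l) (P m))"
proof -
  have "(\<Sum>j<i. unity_root m ^ j) = poly (\<Sum>j<i. r ^ j) (unity_root n)" for i
    by (simp add: poly_sum r(2))
  moreover have "int_coeffs (\<Sum>j<i. r ^ j)" for i
    using r(1) by (intro int_coeffs_sum int_coeffs_power)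
  ultimately have "P m \<subseteq> {poly p (unity_root n) | p. int_coeffs p}" unfolding P_def by blast
  moreover have "finite (P m)" unfolding P_def by auto
  ultimately show ?thesis
    unfolding meyer_set_def
    using relatively_dense_Q_P[OF l m] uniform_discrete_diff_Q[OF n _ _ q conj] by blast
qed

section \<open>The multipliers and their conjugates\<close>

lemma norm_one_plus_cis_squared: "(norm (1 + cis x))\<^sup>2 = 2 + 2 * cos x"
proof -
  have "(norm (1 + cis x))\<^sup>2 = 1 + 2 * cos x + ((cos x)\<^sup>2 + (sin x)\<^sup>2)"
    unfolding cmod_power2 by (simp add: power2_eq_square algebra_simps)
  then show ?thesis by simp
qed

lemma lam_gt_1:
  assumes "n > 3"
  shows "lam n > 1"
proof -
  have "cos (pi / n) > cos (pi / 3)"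
    using assms by (intro cos_monotone_0_pi) (auto simp: field_simps)
  moreover have "cos (pi / n) < cos 0"
    using assms by (intro cos_monotone_0_pi) (auto simp: field_simps)
  ultimately show ?thesis unfolding lam_def by (simp add: cos_60 field_simps)
qed

text \<open>For odd \<open>n\<close> the number \<open>\<lambda>\<^sub>n\<close> is the squared length of the longest diagonal of the regular
  \<open>n\<close>-gon of side \<open>1\<close>; the second factor is the conjugate of the first, as \<open>\<zeta>\<^bsup>n-1\<^esup> = \<zeta>\<^bsup>-1\<^esup>\<close>.\<close>

definition diagonal_poly :: "nat \<Rightarrow> complex poly" where
  "diagonal_poly n = (\<Sum>j<(n + 1) div 2. monom 1 j) * (\<Sum>j<(n + 1) div 2. monom 1 ((n - 1) * j))"

lemma int_coeffs_diagonal_poly: "int_coeffs (diagonal_poly n)"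
  unfolding diagonal_poly_def by (intro int_coeffs_mult int_coeffs_sum int_coeffs_monom) auto

text \<open>For \<open>h = (n + 1) div 2\<close> the power \<open>z ^ h\<close> is a square root of
  \<open>z\<close>, so the geometric sum \<open>g\<close> is the inverse of
  \<open>1 + z ^ h\<close>, and the polynomial takes the value \<open>g * cnj g\<close>. The sign
  comes from the angle \<open>pi * k + k * pi / n\<close> of \<open>z ^ h\<close>.\<close>

lemma poly_diagonal_poly:
  assumes n: "odd n" "\<not> n dvd k"
  shows "poly (diagonal_poly n) (unity_root n ^ k)
    = of_real (1 / (2 + 2 * (-1) ^ k * cos (k * pi / n)))"
proof -
  have n0: "n > 0" using n odd_pos by blast
  define h where "h = (n + 1) div 2"
  have h: "2 * h = n + 1" using n by (simp add: h_def)
  define z where "z = unity_root n ^ k"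
  define g where "g = (\<Sum>j<h. z ^ j)"
  have z1: "z \<noteq> 1" unfolding z_def using n unity_root_power_eq_1_iff[OF n0] by blast
  have zn: "z ^ n = 1"
    using unity_root_power_eq_1_iff[OF n0, of "k * n"] by (simp add: z_def power_mult)
  have sq: "(z ^ h)\<^sup>2 = z"
    using zn h by (simp add: power_mult[symmetric] mult.commute)
  have "g * (1 - z) = 1 - z ^ h"
    unfolding g_def using one_diff_power_eq[of z h] by (simp add: mult.commute)
  then have "g * (1 + z ^ h) * (1 - z ^ h) = 1 * (1 - z ^ h)"
    using sq by (simp add: algebra_simps power2_eq_square)
  moreover have "1 - z ^ h \<noteq> 0" using z1 sq by auto
  ultimately have "g * (1 + z ^ h) = 1" by (metis mult_right_cancel)
  then have g: "norm g * norm (1 + z ^ h) = 1" by (metis norm_mult norm_one)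
  have h': "2 * real h = real n + 1" using h by linarith
  have "real h * (real k * (2 * pi / n)) = real k * (2 * real h) * pi / n" by simp
  also have "\<dots> = pi * k + k * pi / n" unfolding h' using n0 by (simp add: field_simps)
  finally have "real h * (real k * (2 * pi / n)) = pi * k + k * pi / n" .
  then have "z ^ h = cis (pi * k + k * pi / n)"
    unfolding z_def Complex.DeMoivre by (simp only:)
  then have "(norm (1 + z ^ h))\<^sup>2 = 2 + 2 * cos (pi * k + k * pi / n)"
    by (simp only: norm_one_plus_cis_squared)
  also have "cos (pi * k + k * pi / n) = (-1) ^ k * cos (k * pi / n)"
    by (simp add: cos_add mult.commute[of pi])
  finally have *: "(norm (1 + z ^ h))\<^sup>2 = 2 + 2 * (-1) ^ k * cos (k * pi / n)" by simp
  have "(norm g)\<^sup>2 * (norm (1 + z ^ h))\<^sup>2 = 1"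
    using g by (simp add: power_mult_distrib[symmetric])
  then have norm_g: "(norm g)\<^sup>2 = 1 / (2 + 2 * (-1) ^ k * cos (k * pi / n))"
    unfolding * by (metis nonzero_eq_divide_eq mult_zero_right zero_neq_one)
  have "poly (diagonal_poly n) z = g * (\<Sum>j<h. (z ^ (n - 1)) ^ j)"
    by (simp add: diagonal_poly_def poly_sum poly_monom g_def h_def power_mult)
  also have "\<dots> = g * cnj g"
    using unity_root_power_pred[OF n0, of k] by (simp add: z_def g_def)
  also have "\<dots> = of_real ((norm g)\<^sup>2)" by (rule complex_norm_square[symmetric])
  finally show ?thesis unfolding norm_g z_def .
qed

text \<open>The condition on \<open>k\<close> says that \<open>(-1) ^ k * cos (k * pi / n)\<close>
  is at least -1/2, so the denominator of the conjugate is at least 1 and the conjugate lies in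
  [0, 1].\<close>

lemma meyer_set_Q_lam:
  assumes n: "odd n" "n > 3"
    and conj: "\<forall>k<n. coprime k n \<longrightarrow> k \<noteq> 1 \<longrightarrow> k \<noteq> n - 1 \<longrightarrow>
      (if even k then 3 * k \<le> 2 * n else n \<le> 3 * k)"
  shows "meyer_set (Q (of_real (lam n)) (P n))" "meyer_set (Q (of_real (lam n)) (P (2 * n)))"
proof -
  have lam: "poly (diagonal_poly n) (unity_root n) = of_real (lam n)"
    using poly_diagonal_poly[of n 1] n by (simp add: lam_def algebra_simps)
  have c: "\<exists>c::real. 0 \<le> c \<and> c \<le> 1 \<and> poly (diagonal_poly n) (unity_root n ^ k) = of_real c"
    if k: "k < n" "coprime k n" "k \<noteq> 1" "k \<noteq> n - 1" for k
  proof -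
    have "\<not> n dvd k" using k n by (auto dest: dvd_imp_le intro!: gr0I)
    have le: "(-1) ^ k * cos (k * pi / n) \<ge> - (1 / 2)"
    proof (cases "even k")
      case True
      then have "real (3 * k) \<le> real (2 * n)" using conj k by (simp only: of_nat_le_iff) auto
      then have "cos (2 * pi / 3) \<le> cos (k * pi / n)"
        using n by (intro cos_monotone_0_pi_le) (auto simp: field_simps)
      then show ?thesis using True by (simp add: cos_120)
    next
      case False
      then have "real n \<le> real (3 * k)" using conj k by (simp only: of_nat_le_iff) auto
      then have "cos (k * pi / n) \<le> cos (pi / 3)"
        using n k(1) by (intro cos_monotone_0_pi_le) (auto simp: field_simps)
      then show ?thesis using False by (simp add: cos_60)
    qed
    then show ?thesis
      using poly_diagonal_poly[OF n(1) \<open>\<not> n dvd k\<close>]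
      by (intro exI[of _ "1 / (2 + 2 * (-1) ^ k * cos (k * pi / n))"]) (simp add: field_simps)
  qed
  have n2: "n \<ge> 2" "n \<ge> 3" "2 * n \<ge> 3" using n by auto
  show "meyer_set (Q (of_real (lam n)) (P n))"
    by (rule meyer_set_Q_P[OF n2(1,2) lam_gt_1[OF n(2)] _ _ int_coeffs_diagonal_poly lam c,
          where r = "monom 1 1"])
       (auto simp: int_coeffs_monom poly_monom)
  \<comment> \<open>As \<open>n\<close> is odd, the primitive 2n-th root of unity is
    \<open>- (unity_root n ^ h)\<close>, which already lies in the ring of the n-gon.\<close>
  define h where "h = (n + 1) div 2"
  have "real h = (real n + 1) / 2" using n by (auto simp: h_def real_of_nat_div elim!: oddE)
  then have "real h * (2 * pi / n) = pi + 2 * pi / real (2 * n)"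
    using n by (simp add: field_simps)
  then have "unity_root n ^ h = cis pi * unity_root (2 * n)"
    unfolding Complex.DeMoivre cis_mult by (simp only:)
  then have root: "unity_root (2 * n) = poly (monom (-1) h) (unity_root n)"
    by (simp add: poly_monom)
  show "meyer_set (Q (of_real (lam n)) (P (2 * n)))"
    by (rule meyer_set_Q_P[OF n2(1,3) lam_gt_1[OF n(2)] _ root int_coeffs_diagonal_poly lam c])
       (auto simp: int_coeffs_monom)
qed

text \<open>The multiplier is 2 + \<zeta> + 1/\<zeta>. Its conjugate is at most 1 when the angle of
  \<open>\<zeta> ^ k\<close> is within \<pi>/3 of \<pi>, that is, when k/n lies between 1/3 and
  2/3.\<close>

lemma meyer_set_Q_two_plus_two_cos:
  assumes n: "n > 3"
    and conj: "\<forall>k<n. coprime k n \<longrightarrow> k \<noteq> 1 \<longrightarrow> k \<noteq> n - 1 \<longrightarrow> n \<le> 3 * k \<and> 3 * k \<le> 2 * n"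
  shows "meyer_set (Q (of_real (2 + 2 * cos (2 * pi / n))) (P n))"
proof -
  define q :: "complex poly" where "q = [:2:] + monom 1 1 + monom 1 (n - 1)"
  have q: "poly q (unity_root n ^ k) = of_real (2 + 2 * cos (real k * (2 * pi / n)))" for k
  proof -
    have "poly q (unity_root n ^ k) = 2 + unity_root n ^ k + cnj (unity_root n ^ k)"
      using unity_root_power_pred[of n k] n by (simp add: q_def poly_monom)
    also have "\<dots> = of_real (2 + 2 * cos (real k * (2 * pi / n)))"
      unfolding Complex.DeMoivre by (simp add: complex_eq_iff)
    finally show ?thesis .
  qed
  have c: "\<exists>c::real. 0 \<le> c \<and> c \<le> 1 \<and> poly q (unity_root n ^ k) = of_real c"
    if k: "k < n" "coprime k n" "k \<noteq> 1" "k \<noteq> n - 1" for k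
  proof -
    have "n \<le> 3 * k" "3 * k \<le> 2 * n" using conj k by auto
    then have "real n \<le> 3 * real k" "3 * real k \<le> 2 * real n" by linarith+
    then have "\<bar>real n - 2 * real k\<bar> \<le> real n / 3" by linarith
    then have "pi / n * \<bar>real n - 2 * real k\<bar> \<le> pi / n * (real n / 3)"
      by (rule mult_left_mono) simp
    moreover have "pi - real k * (2 * pi / n) = pi / n * (real n - 2 * real k)"
      using n by (simp add: field_simps)
    ultimately have "\<bar>pi - real k * (2 * pi / n)\<bar> \<le> pi / 3" using n by (simp add: abs_mult)
    then have "cos (pi / 3) \<le> cos \<bar>pi - real k * (2 * pi / n)\<bar>"
      by (intro cos_monotone_0_pi_le) auto
    then have "cos (real k * (2 * pi / n)) \<le> - (1 / 2)"
      unfolding cos_abs_real by (simp add: cos_diff cos_60)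
    moreover have "cos (real k * (2 * pi / n)) \<ge> - 1" by simp
    ultimately have "0 \<le> 2 + 2 * cos (real k * (2 * pi / n)) \<and>
        2 + 2 * cos (real k * (2 * pi / n)) \<le> 1"
      by linarith
    then show ?thesis using q by blast
  qed
  have "cos (2 * pi / n) \<ge> cos (pi / 2)"
    using n by (intro cos_monotone_0_pi_le) (auto simp: field_simps)
  then have l: "2 + 2 * cos (2 * pi / n) > 1" by simp
  have q1: "poly q (unity_root n) = of_real (2 + 2 * cos (2 * pi / n))" using q[of 1] by simp
  have int_q: "int_coeffs q"
    unfolding q_def by (intro int_coeffs_add int_coeffs_monom int_coeffs_const) auto
  show ?thesis
    using n by (intro meyer_set_Q_P[OF _ _ l _ _ int_q q1 c, where r = "monom 1 1"])
      (auto simp: int_coeffs_monom poly_monom)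
qed

theorem corollary15p42:
  shows "(meyer_set (Q (complex_of_real (lam 5)) (P 5)) \<and>
          meyer_set (Q (complex_of_real (lam 5)) (P 10))) \<and>
         (meyer_set (Q (complex_of_real (lam 7)) (P 7)) \<and>
          meyer_set (Q (complex_of_real (lam 7)) (P 14))) \<and>
         meyer_set (Q (complex_of_real (2 + sqrt 2)) (P 8)) \<and>
         meyer_set (Q (complex_of_real (2 + sqrt 3)) (P 12)) \<and>
         (meyer_set (Q (complex_of_real (lam 9)) (P 9)) \<and>
          meyer_set (Q (complex_of_real (lam 9)) (P 18))) \<and>
         (meyer_set (Q (complex_of_real (lam 15)) (P 15)) \<and>
          meyer_set (Q (complex_of_real (lam 15)) (P 30)))"
proof -
  \<comment> \<open>What is left is arithmetic on finitely many residues; for 8 they are 3 and 5,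
    for 12 they are 5 and 7.\<close>
  have odd_conj: "\<forall>n\<in>{5, 7, 9, 15::nat}. \<forall>k<n. coprime k n \<longrightarrow> k \<noteq> 1 \<longrightarrow> k \<noteq> n - 1 \<longrightarrow>
      (if even k then 3 * k \<le> 2 * n else n \<le> 3 * k)"
    by code_simp
  have even_conj: "\<forall>n\<in>{8, 12::nat}. \<forall>k<n. coprime k n \<longrightarrow> k \<noteq> 1 \<longrightarrow> k \<noteq> n - 1 \<longrightarrow>
      n \<le> 3 * k \<and> 3 * k \<le> 2 * n"
    by code_simp
  have odd_case: "meyer_set (Q (of_real (lam n)) (P n)) \<and> meyer_set (Q (of_real (lam n)) (P (2 * n)))"
    if "n \<in> {5, 7, 9, 15}" for n
    using meyer_set_Q_lam[OF _ _ bspec[OF odd_conj that]] that by auto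
  have even_case: "meyer_set (Q (of_real (2 + 2 * cos (2 * pi / real n))) (P n))"
    if "n \<in> {8, 12}" for n
    using meyer_set_Q_two_plus_two_cos[OF _ bspec[OF even_conj that]] that by auto
  have "2 * cos (2 * pi / real 8) = sqrt 2" "2 * cos (2 * pi / real 12) = sqrt 3"
    by (simp_all add: cos_45 cos_30)
  then show ?thesis
    using odd_case[of 5] odd_case[of 7] odd_case[of 9] odd_case[of 15]
      even_case[of 8] even_case[of 12] by simp
qed

end
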